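(* Suppose that $R$ is a right Noetherian ring, $S\in \mathrm{Den}(R,0)$ and $S^{-1}R$ is a left Noetherian ring (e.g. $R$ is a Noetherian ring). Then $$\min(S^{-1}R)=\{S^{-1}\mathfrak{p}\mid \mathfrak{p}\in \min(R,S)\}.$$ In particular, $\min(R,S)\neq\emptyset$.
   Context: Rings are associative with $1$. A multiplicative subset $S$ of $R$ is a multiplicative subsemigroup with $1\in S$, $0\notin S$. It is a left Ore set if $Sr\cap Rs\neq\emptyset$ for all $r\in R$, $s\in S$. A left Ore set $S$ is a left denominator set if $rs=0$ with $r\in R$, $s\in S$ implies $tr=0$ for some $t\in S$. Right Ore and right denominator sets are defined symmetrically; a denominator set is a left and right denominator set. $\mathrm{Den}(R,0)$ is the set of (left and right) denominator sets $S$ of $R$ with $\mathrm{ass}(S)=\{r\in R\mid sr=0\text{ for some }s\in S\}=0$. $S^{-1}R=\{s^{-1}r\mid s\in S,r\in R\}$ is the localization of $R$ at $S$ and $S^{-1}\mathfrak{p}=\{s^{-1}p\mid s\in S,p\in\mathfrak{p}\}$. $\min(R)$ is the set of minimal prime ideals of $R$ and $\min(R,S)=\{\mathfrak{p}\in\min(R)\mid \mathfrak{p}\cap S=\emptyset\}$. *)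

theory Defs
  imports "HOL-Algebra.Algebra"
begin

text \<open>
  The rings below are associative with one but need not be commutative.  The library's
  \<^const>\<open>ideal\<close> is the two-sided notion, valid over any ring, but \<^const>\<open>primeideal\<close>
  is tied to commutative rings and \<^const>\<open>noetherian_ring\<close> is about two-sided ideals, so the
  one-sided and noncommutative notions are introduced here.
\<close>

definition left_ideal :: "'a set \<Rightarrow> ('a, 'm) ring_scheme \<Rightarrow> bool" where
  "left_ideal I R \<longleftrightarrow>
     additive_subgroup I R \<and> (\<forall>x\<in>carrier R. \<forall>a\<in>I. x \<otimes>\<^bsub>R\<^esub> a \<in> I)"

definition right_ideal :: "'a set \<Rightarrow> ('a, 'm) ring_scheme \<Rightarrow> bool" where
  "right_ideal I R \<longleftrightarrow>
     additive_subgroup I R \<and> (\<forall>x\<in>carrier R. \<forall>a\<in>I. a \<otimes>\<^bsub>R\<^esub> x \<in> I)"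

definition left_noetherian :: "('a, 'm) ring_scheme \<Rightarrow> bool" where
  "left_noetherian R \<longleftrightarrow>
     (\<forall>I :: nat \<Rightarrow> 'a set. (\<forall>n. left_ideal (I n) R) \<and> (\<forall>n. I n \<subseteq> I (Suc n))
        \<longrightarrow> (\<exists>n. \<forall>m\<ge>n. I m = I n))"

definition right_noetherian :: "('a, 'm) ring_scheme \<Rightarrow> bool" where
  "right_noetherian R \<longleftrightarrow>
     (\<forall>I :: nat \<Rightarrow> 'a set. (\<forall>n. right_ideal (I n) R) \<and> (\<forall>n. I n \<subseteq> I (Suc n))
        \<longrightarrow> (\<exists>n. \<forall>m\<ge>n. I m = I n))"

definition prime_ideal :: "'a set \<Rightarrow> ('a, 'm) ring_scheme \<Rightarrow> bool" where
  "prime_ideal P R \<longleftrightarrow>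
     ideal P R \<and> P \<noteq> carrier R \<and>
     (\<forall>I J. ideal I R \<longrightarrow> ideal J R \<longrightarrow> ideal_prod R I J \<subseteq> P \<longrightarrow> I \<subseteq> P \<or> J \<subseteq> P)"

definition min_primes :: "('a, 'm) ring_scheme \<Rightarrow> 'a set set" where
  "min_primes R = {P. prime_ideal P R \<and> (\<forall>P'. prime_ideal P' R \<longrightarrow> P' \<subseteq> P \<longrightarrow> P' = P)}"

definition min_primes_avoiding :: "('a, 'm) ring_scheme \<Rightarrow> 'a set \<Rightarrow> 'a set set" where
  "min_primes_avoiding R S = {P \<in> min_primes R. P \<inter> S = {}}"

definition multiplicative_subset :: "('a, 'm) ring_scheme \<Rightarrow> 'a set \<Rightarrow> bool" where
  "multiplicative_subset R S \<longleftrightarrow> submonoid S R \<and> \<zero>\<^bsub>R\<^esub> \<notin> S"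

definition left_Ore_set :: "('a, 'm) ring_scheme \<Rightarrow> 'a set \<Rightarrow> bool" where
  "left_Ore_set R S \<longleftrightarrow> multiplicative_subset R S \<and>
     (\<forall>r\<in>carrier R. \<forall>s\<in>S. (S #>\<^bsub>R\<^esub> r) \<inter> (carrier R #>\<^bsub>R\<^esub> s) \<noteq> {})"

definition right_Ore_set :: "('a, 'm) ring_scheme \<Rightarrow> 'a set \<Rightarrow> bool" where
  "right_Ore_set R S \<longleftrightarrow> multiplicative_subset R S \<and>
     (\<forall>r\<in>carrier R. \<forall>s\<in>S. (r <#\<^bsub>R\<^esub> S) \<inter> (s <#\<^bsub>R\<^esub> carrier R) \<noteq> {})"

definition left_denominator_set :: "('a, 'm) ring_scheme \<Rightarrow> 'a set \<Rightarrow> bool" where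
  "left_denominator_set R S \<longleftrightarrow> left_Ore_set R S \<and>
     (\<forall>r\<in>carrier R. \<forall>s\<in>S. r \<otimes>\<^bsub>R\<^esub> s = \<zero>\<^bsub>R\<^esub> \<longrightarrow> (\<exists>t\<in>S. t \<otimes>\<^bsub>R\<^esub> r = \<zero>\<^bsub>R\<^esub>))"

definition right_denominator_set :: "('a, 'm) ring_scheme \<Rightarrow> 'a set \<Rightarrow> bool" where
  "right_denominator_set R S \<longleftrightarrow> right_Ore_set R S \<and>
     (\<forall>r\<in>carrier R. \<forall>s\<in>S. s \<otimes>\<^bsub>R\<^esub> r = \<zero>\<^bsub>R\<^esub> \<longrightarrow> (\<exists>t\<in>S. r \<otimes>\<^bsub>R\<^esub> t = \<zero>\<^bsub>R\<^esub>))"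

definition ass :: "('a, 'm) ring_scheme \<Rightarrow> 'a set \<Rightarrow> 'a set" where
  "ass R S = {r \<in> carrier R. \<exists>s\<in>S. s \<otimes>\<^bsub>R\<^esub> r = \<zero>\<^bsub>R\<^esub>}"

definition Den :: "('a, 'm) ring_scheme \<Rightarrow> 'a set \<Rightarrow> 'a set set" where
  "Den R \<aa> = {S. left_denominator_set R S \<and> right_denominator_set R S \<and> ass R S = \<aa>}"

text \<open>
  The set of left fractions with denominators in \<open>S\<close> and numerators in \<open>A\<close>, computed in a
  ring \<open>Q\<close> through a map \<open>\<phi>\<close> from the ring of numerators.
\<close>

definition fractions :: "('b, 'n) ring_scheme \<Rightarrow> ('a \<Rightarrow> 'b) \<Rightarrow> 'a set \<Rightarrow> 'a set \<Rightarrow> 'b set" where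
  "fractions Q \<phi> S A = {inv\<^bsub>Q\<^esub> (\<phi> s) \<otimes>\<^bsub>Q\<^esub> \<phi> a | s a. s \<in> S \<and> a \<in> A}"

text \<open>
  \<open>is_localization R S Q \<phi>\<close>: the ring \<open>Q\<close>, with canonical map \<open>\<phi>\<close>, is the localization
  \<open>S\<^sup>-\<^sup>1R\<close> in the sense of Ore.  For a left denominator set \<open>S\<close> such a pair exists and
  is unique up to a unique isomorphism over \<open>R\<close>; when \<open>ass R S\<close> is zero, \<open>\<phi>\<close> is injective and
  is the inclusion that is usually suppressed in writing \<open>s\<^sup>-\<^sup>1r\<close>.
\<close>

definition is_localization ::
  "('a, 'm) ring_scheme \<Rightarrow> 'a set \<Rightarrow> ('b, 'n) ring_scheme \<Rightarrow> ('a \<Rightarrow> 'b) \<Rightarrow> bool" where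
  "is_localization R S Q \<phi> \<longleftrightarrow>
     ring Q \<and> \<phi> \<in> ring_hom R Q \<and> \<phi> ` S \<subseteq> Units Q \<and>
     a_kernel R Q \<phi> = ass R S \<and> carrier Q = fractions Q \<phi> S (carrier R)"

end

theory Submission
  imports Defs
begin

text \<open>
  Contraction along \<open>\<phi>\<close> and extension \<open>I \<mapsto> S\<^sup>-\<^sup>1I\<close> are mutually inverse, inclusion preserving
  bijections between the primes of \<open>S\<^sup>-\<^sup>1R\<close> and the primes of \<open>R\<close> that do not meet \<open>S\<close>; such
  primes form a down-set, so minimality matches on both sides.  Two finiteness
  arguments replace commutativity.  If \<open>I\<close> is a two-sided ideal of \<open>R\<close> then so is \<open>S\<^sup>-\<^sup>1I\<close>, because
  the ascending left ideals \<open>(S\<^sup>-\<^sup>1I)s\<^sup>-\<^sup>n\<close> become stationary.  If \<open>P\<close> is a prime of \<open>R\<close> not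
  meeting \<open>S\<close> and \<open>T\<close> is the contraction of \<open>S\<^sup>-\<^sup>1P\<close>, then the directed right ideals
  \<open>{r. sr \<in> P}\<close> have union \<open>T\<close>, so \<open>sT \<subseteq> P\<close> for a single \<open>s \<in> S\<close>; then \<open>sRT \<subseteq> P\<close> and \<open>T = P\<close>.
\<close>

section \<open>One-sided ideals\<close>

text \<open>Closure under negation is derived from multiplication by
  \<open>\<ominus> \<one>\<close>, so later proofs check only zero, sums and one-sided
  multiples.\<close>

lemma (in ring) left_idealI:
  assumes "H \<subseteq> carrier R" "\<zero> \<in> H"
    and "\<And>a b. a \<in> H \<Longrightarrow> b \<in> H \<Longrightarrow> a \<oplus> b \<in> H"
    and mult: "\<And>x a. x \<in> carrier R \<Longrightarrow> a \<in> H \<Longrightarrow> x \<otimes> a \<in> H"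
  shows "left_ideal H R"
proof -
  have "\<ominus> a \<in> H" if "a \<in> H" for a
    using mult[of "\<ominus> \<one>" a] that assms(1) by (auto simp: l_minus)
  then have "subgroup H (add_monoid R)"
    using assms by (intro add.subgroupI) (auto simp: a_inv_def)
  then show ?thesis
    using mult by (simp add: left_ideal_def additive_subgroupI)
qed

lemma (in ring) right_idealI:
  assumes "H \<subseteq> carrier R" "\<zero> \<in> H"
    and "\<And>a b. a \<in> H \<Longrightarrow> b \<in> H \<Longrightarrow> a \<oplus> b \<in> H"
    and mult: "\<And>x a. x \<in> carrier R \<Longrightarrow> a \<in> H \<Longrightarrow> a \<otimes> x \<in> H"
  shows "right_ideal H R"
proof -
  have "\<ominus> a \<in> H" if "a \<in> H" for a
    using mult[of "\<ominus> \<one>" a] that assms(1) by (auto simp: r_minus)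
  then have "subgroup H (add_monoid R)"
    using assms by (intro add.subgroupI) (auto simp: a_inv_def)
  then show ?thesis
    using mult by (simp add: right_ideal_def additive_subgroupI)
qed

lemma (in ring) ideal_iff: "ideal I R \<longleftrightarrow> left_ideal I R \<and> right_ideal I R"
proof
  assume "ideal I R"
  then interpret ideal I R .
  show "left_ideal I R \<and> right_ideal I R"
    by (simp add: left_ideal_def right_ideal_def additive_subgroup_axioms I_l_closed I_r_closed)
qed (auto simp: left_ideal_def right_ideal_def ideal_def ideal_axioms_def ring_axioms)

lemma left_idealD:
  assumes "left_ideal I R"
  shows "I \<subseteq> carrier R" "\<zero>\<^bsub>R\<^esub> \<in> I"
    "\<And>a b. a \<in> I \<Longrightarrow> b \<in> I \<Longrightarrow> a \<oplus>\<^bsub>R\<^esub> b \<in> I"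
    "\<And>x a. x \<in> carrier R \<Longrightarrow> a \<in> I \<Longrightarrow> x \<otimes>\<^bsub>R\<^esub> a \<in> I"
  using assms additive_subgroup.a_subset additive_subgroup.zero_closed additive_subgroup.a_closed
  by (auto simp: left_ideal_def)

lemma right_idealD:
  assumes "right_ideal I R"
  shows "I \<subseteq> carrier R" "\<zero>\<^bsub>R\<^esub> \<in> I"
    "\<And>a b. a \<in> I \<Longrightarrow> b \<in> I \<Longrightarrow> a \<oplus>\<^bsub>R\<^esub> b \<in> I"
    "\<And>x a. x \<in> carrier R \<Longrightarrow> a \<in> I \<Longrightarrow> a \<otimes>\<^bsub>R\<^esub> x \<in> I"
  using assms additive_subgroup.a_subset additive_subgroup.zero_closed additive_subgroup.a_closed
  by (auto simp: right_ideal_def)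

text \<open>Suppose no member is largest. Then each \<open>T i\<close> fails to contain some
  \<open>T j\<close>, and a member above both is strictly larger than \<open>T i\<close>. Dependent
  choice turns this into a strictly ascending sequence of right ideals.\<close>

lemma right_noetherian_directed_max:
  fixes R :: "('a, 'm) ring_scheme" and T :: "'i \<Rightarrow> 'a set"
  assumes noeth: "right_noetherian R" and ne: "A \<noteq> {}"
    and T: "\<And>i. i \<in> A \<Longrightarrow> right_ideal (T i) R"
    and dir: "\<And>i j. i \<in> A \<Longrightarrow> j \<in> A \<Longrightarrow> \<exists>k\<in>A. T i \<subseteq> T k \<and> T j \<subseteq> T k"
  obtains m where "m \<in> A" "\<And>i. i \<in> A \<Longrightarrow> T i \<subseteq> T m"
proof -
  have "\<exists>m\<in>A. \<forall>i\<in>A. T i \<subseteq> T m"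
  proof (rule ccontr)
    assume "\<not> ?thesis"
    then have step: "\<exists>j. j \<in> A \<and> T i \<subset> T j" if "i \<in> A" for i
      using dir that by (metis order_trans psubsetI)
    obtain f where f: "\<And>n. f n \<in> A" "\<And>n. T (f n) \<subset> T (f (Suc n))"
      using dependent_nat_choice[of "\<lambda>_ i. i \<in> A" "\<lambda>_ i j. T i \<subset> T j"] ne step by (metis ex_in_conv)
    obtain n where "\<And>m. m \<ge> n \<Longrightarrow> T (f m) = T (f n)"
      using noeth[unfolded right_noetherian_def, rule_format, of "\<lambda>n. T (f n)"] f T by blast
    then show False
      using f(2)[of n] by (metis le_SucI order_refl psubset_eq)
  qed
  then show ?thesis
    using that by blast
qed

section \<open>Prime ideals\<close>

lemma ideal_prod_subset:
  assumes "ideal P R" "\<And>a b. a \<in> I \<Longrightarrow> b \<in> J \<Longrightarrow> a \<otimes>\<^bsub>R\<^esub> b \<in> P"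
  shows "ideal_prod R I J \<subseteq> P"
proof
  fix x assume "x \<in> ideal_prod R I J"
  then show "x \<in> P"
    by induction (use assms in \<open>auto intro: additive_subgroup.a_closed ideal.axioms(1)\<close>)
qed

text \<open>\<open>ideal_prod\<close> is additively generated by products of elements, so primeness
  of an ideal can be tested on such products, and properness on \<open>\<one>\<close>. The
  elimination counterpart is \<open>prime_idealD\<close>.\<close>

lemma (in ring) prime_idealI:
  assumes "ideal P R" "\<one> \<notin> P"
    and "\<And>I J. ideal I R \<Longrightarrow> ideal J R \<Longrightarrow> (\<And>a b. a \<in> I \<Longrightarrow> b \<in> J \<Longrightarrow> a \<otimes> b \<in> P) \<Longrightarrow>
      I \<subseteq> P \<or> J \<subseteq> P"
  shows "prime_ideal P R"
proof -
  have "P \<noteq> carrier R"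
    using assms(2) by blast
  moreover have "I \<subseteq> P \<or> J \<subseteq> P" if "ideal I R" "ideal J R" "ideal_prod R I J \<subseteq> P" for I J
    using assms(3)[OF that(1,2)] that(3) by (blast intro: ideal_prod.prod)
  ultimately show ?thesis
    using assms(1) by (auto simp: prime_ideal_def)
qed

lemma prime_idealD:
  assumes "prime_ideal P R"
  shows "ideal P R" "\<one>\<^bsub>R\<^esub> \<notin> P"
    "\<And>I J. ideal I R \<Longrightarrow> ideal J R \<Longrightarrow> (\<And>a b. a \<in> I \<Longrightarrow> b \<in> J \<Longrightarrow> a \<otimes>\<^bsub>R\<^esub> b \<in> P) \<Longrightarrow>
      I \<subseteq> P \<or> J \<subseteq> P"
proof -
  show P: "ideal P R"
    using assms by (simp add: prime_ideal_def)
  show "\<one>\<^bsub>R\<^esub> \<notin> P"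
    using assms ideal.one_imp_carrier[OF P] by (auto simp: prime_ideal_def)
  show "I \<subseteq> P \<or> J \<subseteq> P"
    if "ideal I R" "ideal J R" "\<And>a b. a \<in> I \<Longrightarrow> b \<in> J \<Longrightarrow> a \<otimes>\<^bsub>R\<^esub> b \<in> P" for I J
    using assms that ideal_prod_subset[OF P that(3)] by (simp add: prime_ideal_def)
qed

text \<open>The elements that multiply \<open>T\<close> into \<open>P\<close> from the left form an
  ideal \<open>I\<close>; it is closed under right multiplication because \<open>T\<close> absorbs
  left multiplication. Since \<open>I\<close> times \<open>T\<close> lies in \<open>P\<close> and
  \<open>s\<close> is in \<open>I\<close> but not in \<open>P\<close>, primeness leaves only
  \<open>T \<subseteq> P\<close>.\<close>

lemma (in ring) prime_ideal_elementwise: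
  assumes P: "prime_ideal P R" and s: "s \<in> carrier R" and T: "ideal T R"
    and prod: "\<And>r. r \<in> T \<Longrightarrow> s \<otimes> r \<in> P" and "s \<notin> P"
  shows "T \<subseteq> P"
proof -
  interpret P: ideal P R by (rule prime_idealD(1)[OF P])
  interpret T: ideal T R by (rule T)
  define I where "I = {x \<in> carrier R. \<forall>r\<in>T. x \<otimes> r \<in> P}"
  have "left_ideal I R"
    by (rule left_idealI)
      (auto simp: I_def l_distr m_assoc P.I_l_closed T.Icarr)
  moreover have "right_ideal I R"
    by (rule right_idealI) (auto simp: I_def l_distr m_assoc T.I_l_closed T.Icarr)
  ultimately have "ideal I R"
    by (simp add: ideal_iff)
  then have "I \<subseteq> P \<or> T \<subseteq> P"
    by (rule prime_idealD(3)[OF P _ T]) (simp add: I_def)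
  moreover have "s \<in> I"
    using s prod by (simp add: I_def)
  ultimately show ?thesis
    using \<open>s \<notin> P\<close> by blast
qed

section \<open>Existence of prime and minimal prime ideals\<close>

text \<open>Zorn's lemma gives an ideal maximal among those without \<open>\<one>\<close>. It is
  prime because any two ideals not contained in it are each comaximal with it.\<close>

lemma (in ring) exists_prime_ideal:
  assumes "\<one> \<noteq> \<zero>"
  shows "\<exists>P. prime_ideal P R"
proof -
  let ?A = "{I. ideal I R \<and> \<one> \<notin> I}"
  have "\<exists>M\<in>?A. \<forall>N\<in>?A. M \<subseteq> N \<longrightarrow> N = M"
  proof (rule subset_Zorn_nonempty)
    show "?A \<noteq> {}"
      using zeroideal assms by blast
    fix C assume C: "C \<noteq> {}" "subset.chain ?A C"
    then have "subset.chain {I. ideal I R} C"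
      by (auto simp: pred_on.chain_def)
    from chain_Union_is_ideal[OF this] C show "\<Union>C \<in> ?A"
      by (auto simp: pred_on.chain_def)
  qed
  then obtain M where M: "ideal M R" "\<one> \<notin> M"
    and max: "\<And>N. ideal N R \<Longrightarrow> \<one> \<notin> N \<Longrightarrow> M \<subseteq> N \<Longrightarrow> N = M"
    by blast
  interpret M: ideal M R by (rule M)
  \<comment> \<open>Otherwise the sum of \<open>I\<close> and \<open>M\<close> would be a proper
    ideal, and maximality would force \<open>I \<subseteq> M\<close>.\<close>
  have comax: "\<exists>a\<in>I. \<exists>m\<in>M. \<one> = a \<oplus> m" if I: "ideal I R" "\<not> I \<subseteq> M" for I
  proof (rule ccontr)
    assume "\<not> ?thesis"
    then have "\<one> \<notin> I <+>\<^bsub>R\<^esub> M"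
      by (auto simp: set_add_def')
    interpret I: ideal I R by (rule I)
    have mem: "i \<oplus> m \<in> I <+>\<^bsub>R\<^esub> M" if "i \<in> I" "m \<in> M" for i m
      using that by (auto simp: set_add_def')
    have "x \<in> I <+>\<^bsub>R\<^esub> M" if "x \<in> M" for x
      using mem[OF I.zero_closed that] M.Icarr[OF that] by simp
    moreover have "x \<in> I <+>\<^bsub>R\<^esub> M" if "x \<in> I" for x
      using mem[OF that M.zero_closed] I.Icarr[OF that] by simp
    ultimately show False
      using max[OF add_ideals[OF I(1) M(1)] \<open>\<one> \<notin> I <+>\<^bsub>R\<^esub> M\<close>] I(2) by blast
  qed
  have "prime_ideal M R"
  proof (rule prime_idealI[OF M], rule ccontr)
    fix I J assume I: "ideal I R" and J: "ideal J R"
      and prod: "\<And>a b. a \<in> I \<Longrightarrow> b \<in> J \<Longrightarrow> a \<otimes> b \<in> M" and n: "\<not> (I \<subseteq> M \<or> J \<subseteq> M)"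
    obtain a m b m' where ab: "a \<in> I" "b \<in> J" "m \<in> M" "m' \<in> M"
      and eq: "\<one> = a \<oplus> m" "\<one> = b \<oplus> m'"
      using comax[OF I] comax[OF J] n by blast
    have carr: "a \<in> carrier R" "b \<in> carrier R" "m \<in> carrier R" "m' \<in> carrier R"
      using ab I J by (auto intro: ideal.Icarr M.Icarr)
    have "\<one> = (a \<oplus> m) \<otimes> (b \<oplus> m')"
      unfolding eq[symmetric] by simp
    \<comment> \<open>Each summand has a factor in \<open>M\<close>, except
      \<open>a \<otimes> b\<close>, which lies in \<open>M\<close> by \<open>prod\<close>.\<close>
    also have "\<dots> = a \<otimes> b \<oplus> a \<otimes> m' \<oplus> m \<otimes> (b \<oplus> m')"
      using carr by (simp add: l_distr r_distr a_ac)
    also have "\<dots> \<in> M"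
      using ab carr prod by (simp add: M.I_l_closed M.I_r_closed)
    finally show False
      using M(2) by simp
  qed
  then show ?thesis ..
qed

text \<open>If \<open>I\<close> is not inside one member of the chain and \<open>J\<close> not
  inside another, then the smaller of the two members contains neither, against its
  primeness.\<close>

lemma (in ring) prime_ideal_chain_Inter:
  assumes "C \<noteq> {}" and prime: "\<And>P. P \<in> C \<Longrightarrow> prime_ideal P R"
    and chain: "\<And>P P'. P \<in> C \<Longrightarrow> P' \<in> C \<Longrightarrow> P \<subseteq> P' \<or> P' \<subseteq> P"
  shows "prime_ideal (\<Inter>C) R"
proof (rule prime_idealI)
  show "ideal (\<Inter>C) R"
    using i_Intersect[of C] assms(1) prime_idealD(1)[OF prime] by blast
  show "\<one> \<notin> \<Inter>C"
    using assms(1) prime prime_idealD(2) by blast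
  fix I J assume "ideal I R" "ideal J R" and "\<And>a b. a \<in> I \<Longrightarrow> b \<in> J \<Longrightarrow> a \<otimes> b \<in> \<Inter>C"
  then have "I \<subseteq> P \<or> J \<subseteq> P" if "P \<in> C" for P
    using prime_idealD(3)[OF prime[OF that], of I J] that by blast
  then show "I \<subseteq> \<Inter>C \<or> J \<subseteq> \<Inter>C"
    using chain by (meson Inter_greatest order_trans)
qed

lemma (in ring) exists_min_prime:
  assumes "\<one> \<noteq> \<zero>"
  shows "min_primes R \<noteq> {}"
proof -
  \<comment> \<open>Zorn's lemma yields maximal elements, so it is applied to complements: the union
    of a chain of complements is the complement of an intersection of primes.\<close>
  let ?A = "uminus ` {P. prime_ideal P R}"
  have "\<exists>M\<in>?A. \<forall>N\<in>?A. M \<subseteq> N \<longrightarrow> N = M"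
  proof (rule subset_Zorn_nonempty)
    show "?A \<noteq> {}"
      using exists_prime_ideal[OF assms] by blast
    fix C assume C: "C \<noteq> {}" "subset.chain ?A C"
    then have "prime_ideal (\<Inter>(uminus ` C)) R"
      by (intro prime_ideal_chain_Inter) (auto simp: pred_on.chain_def)
    moreover have "\<Union>C = - \<Inter>(uminus ` C)"
      by auto
    ultimately show "\<Union>C \<in> ?A"
      by blast
  qed
  then show ?thesis
    unfolding min_primes_def by auto
qed

section \<open>Extension and contraction of ideals\<close>

text \<open>The Ore conditions appear as equations between elements instead of meeting cosets, and
  \<open>inj\<close> is the form in which the vanishing of \<open>ass R S\<close> enters.\<close>

locale regular_localization = R: ring R + Q: ring Q
  for R :: "('a, 'm) ring_scheme" (structure) and Q :: "('b, 'n) ring_scheme" (structure) +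
  fixes S :: "'a set" and \<phi> :: "'a \<Rightarrow> 'b"
  assumes hom: "\<phi> \<in> ring_hom R Q"
    and inj: "inj_on \<phi> (carrier R)"
    and S: "submonoid S R" "\<zero> \<notin> S"
    and left_Ore: "\<And>r s. r \<in> carrier R \<Longrightarrow> s \<in> S \<Longrightarrow>
      \<exists>u\<in>S. \<exists>x\<in>carrier R. u \<otimes> r = x \<otimes> s"
    and right_Ore: "\<And>r s. r \<in> carrier R \<Longrightarrow> s \<in> S \<Longrightarrow>
      \<exists>u\<in>S. \<exists>x\<in>carrier R. r \<otimes> u = s \<otimes> x"
    and unit: "\<And>s. s \<in> S \<Longrightarrow> \<phi> s \<in> Units Q"
    and fracs: "carrier Q = fractions Q \<phi> S (carrier R)"
begin

section \<open>Computing with left and right fractions\<close>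

lemma hom_simps [simp]:
  "r \<in> carrier R \<Longrightarrow> \<phi> r \<in> carrier Q"
  "r \<in> carrier R \<Longrightarrow> t \<in> carrier R \<Longrightarrow> \<phi> (r \<otimes> t) = \<phi> r \<otimes>\<^bsub>Q\<^esub> \<phi> t"
  "r \<in> carrier R \<Longrightarrow> t \<in> carrier R \<Longrightarrow> \<phi> (r \<oplus> t) = \<phi> r \<oplus>\<^bsub>Q\<^esub> \<phi> t"
  "\<phi> \<one> = \<one>\<^bsub>Q\<^esub>" "\<phi> \<zero> = \<zero>\<^bsub>Q\<^esub>"
  using hom ring_hom_zero[OF hom R.ring_axioms Q.ring_axioms]
  by (simp_all add: ring_hom_closed ring_hom_mult ring_hom_add ring_hom_one)

lemma S_carrier [simp]: "s \<in> S \<Longrightarrow> s \<in> carrier R"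
  and S_mult [simp]: "s \<in> S \<Longrightarrow> t \<in> S \<Longrightarrow> s \<otimes> t \<in> S"
  and S_one [simp]: "\<one> \<in> S"
  using S(1) by (auto simp: submonoid_def)

lemma inv_simps [simp]:
  assumes "s \<in> S"
  shows "inv\<^bsub>Q\<^esub> (\<phi> s) \<in> carrier Q" "inv\<^bsub>Q\<^esub> (\<phi> s) \<otimes>\<^bsub>Q\<^esub> \<phi> s = \<one>\<^bsub>Q\<^esub>" "\<phi> s \<otimes>\<^bsub>Q\<^esub> inv\<^bsub>Q\<^esub> (\<phi> s) = \<one>\<^bsub>Q\<^esub>"
  using unit[OF assms] by simp_all

lemma cancel_simps [simp]:
  assumes "s \<in> S" "q \<in> carrier Q"
  shows "inv\<^bsub>Q\<^esub> (\<phi> s) \<otimes>\<^bsub>Q\<^esub> (\<phi> s \<otimes>\<^bsub>Q\<^esub> q) = q" "\<phi> s \<otimes>\<^bsub>Q\<^esub> (inv\<^bsub>Q\<^esub> (\<phi> s) \<otimes>\<^bsub>Q\<^esub> q) = q"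
  using assms by (simp_all flip: Q.m_assoc)

abbreviation ext :: "'a set \<Rightarrow> 'b set"
  where "ext \<equiv> fractions Q \<phi> S"

definition contr :: "'b set \<Rightarrow> 'a set"
  where "contr J = {r \<in> carrier R. \<phi> r \<in> J}"

text \<open>This clears denominators: later arguments handle equations \<open>s q = a\<close> in
  place of inverses.\<close>

lemma mem_ext_iff:
  assumes "I \<subseteq> carrier R"
  shows "q \<in> ext I \<longleftrightarrow> q \<in> carrier Q \<and> (\<exists>s\<in>S. \<exists>a\<in>I. \<phi> s \<otimes>\<^bsub>Q\<^esub> q = \<phi> a)"
proof
  assume "q \<in> ext I"
  then obtain s a where "s \<in> S" "a \<in> I" "q = inv\<^bsub>Q\<^esub> (\<phi> s) \<otimes>\<^bsub>Q\<^esub> \<phi> a"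
    by (auto simp: fractions_def)
  then show "q \<in> carrier Q \<and> (\<exists>s\<in>S. \<exists>a\<in>I. \<phi> s \<otimes>\<^bsub>Q\<^esub> q = \<phi> a)"
    using assms by (intro conjI bexI[of _ s] bexI[of _ a]) auto
next
  assume "q \<in> carrier Q \<and> (\<exists>s\<in>S. \<exists>a\<in>I. \<phi> s \<otimes>\<^bsub>Q\<^esub> q = \<phi> a)"
  then obtain s a where *: "q \<in> carrier Q" "s \<in> S" "a \<in> I" "\<phi> s \<otimes>\<^bsub>Q\<^esub> q = \<phi> a"
    by blast
  then have "q = inv\<^bsub>Q\<^esub> (\<phi> s) \<otimes>\<^bsub>Q\<^esub> \<phi> a"
    by (metis cancel_simps(1))
  then show "q \<in> ext I"
    using * by (auto simp: fractions_def)
qed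

lemma left_fraction:
  assumes "q \<in> carrier Q"
  obtains s r where "s \<in> S" "r \<in> carrier R" "\<phi> s \<otimes>\<^bsub>Q\<^esub> q = \<phi> r"
proof -
  have "q \<in> ext (carrier R)"
    using assms fracs by blast
  then show ?thesis
    unfolding mem_ext_iff[OF subset_refl] using that by blast
qed

text \<open>If \<open>s q = r\<close> and the right Ore condition gives \<open>r u = s x\<close>,
  then cancelling \<open>s\<close> in \<open>s q u = s x\<close> gives
  \<open>q u = x\<close>.\<close>

lemma right_fraction:
  assumes q: "q \<in> carrier Q"
  obtains s r where "s \<in> S" "r \<in> carrier R" "q = \<phi> r \<otimes>\<^bsub>Q\<^esub> inv\<^bsub>Q\<^esub> (\<phi> s)"
proof -
  obtain s r where sr: "s \<in> S" "r \<in> carrier R" "\<phi> s \<otimes>\<^bsub>Q\<^esub> q = \<phi> r"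
    using left_fraction[OF q] .
  obtain u x where ux: "u \<in> S" "x \<in> carrier R" "r \<otimes> u = s \<otimes> x"
    using right_Ore sr by blast
  have "\<phi> s \<otimes>\<^bsub>Q\<^esub> (q \<otimes>\<^bsub>Q\<^esub> \<phi> u) = \<phi> (r \<otimes> u)"
    using sr q ux(1) by (simp flip: Q.m_assoc)
  also have "\<dots> = \<phi> s \<otimes>\<^bsub>Q\<^esub> \<phi> x"
    using ux sr by simp
  finally have "q \<otimes>\<^bsub>Q\<^esub> \<phi> u = \<phi> x"
    using cancel_simps(1)[OF sr(1)] q ux by (metis Q.m_closed S_carrier hom_simps(1))
  then have "\<phi> x \<otimes>\<^bsub>Q\<^esub> inv\<^bsub>Q\<^esub> (\<phi> u) = q"
    using q ux(1) by (metis Q.m_assoc Q.r_one S_carrier hom_simps(1) inv_simps(1,3))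
  then show ?thesis
    using that ux by metis
qed

section \<open>Extension of ideals\<close>

lemma left_ideal_ext:
  assumes I: "left_ideal I R"
  shows "left_ideal (ext I) Q"
proof -
  note I = left_idealD[OF I]
  note mem = mem_ext_iff[OF I(1)]
  have carr [simp]: "a \<in> I \<Longrightarrow> a \<in> carrier R" for a
    using I(1) by blast
  show ?thesis
  proof (rule Q.left_idealI)
    show "ext I \<subseteq> carrier Q"
      by (auto simp: mem)
    show "\<zero>\<^bsub>Q\<^esub> \<in> ext I"
      unfolding mem using I(2) by (intro conjI bexI[of _ \<one>] bexI[of _ \<zero>]) auto
  next
    fix p q assume "p \<in> ext I" "q \<in> ext I"
    then obtain s a t b where p: "p \<in> carrier Q" "s \<in> S" "a \<in> I" "\<phi> s \<otimes>\<^bsub>Q\<^esub> p = \<phi> a"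
      and q: "q \<in> carrier Q" "t \<in> S" "b \<in> I" "\<phi> t \<otimes>\<^bsub>Q\<^esub> q = \<phi> b"
      unfolding mem by blast
    \<comment> \<open>The left Ore condition makes \<open>u s = x t\<close> a common left
      denominator of \<open>p\<close> and \<open>q\<close>.\<close>
    obtain u x where ux: "u \<in> S" "x \<in> carrier R" "u \<otimes> s = x \<otimes> t"
      using left_Ore p q by (metis S_carrier)
    have "\<phi> (u \<otimes> s) \<otimes>\<^bsub>Q\<^esub> p = \<phi> (u \<otimes> a)"
      using p ux(1) by (simp add: Q.m_assoc)
    moreover have "\<phi> (u \<otimes> s) \<otimes>\<^bsub>Q\<^esub> q = \<phi> (x \<otimes> b)"
      unfolding ux(3) using q ux(2) by (simp add: Q.m_assoc)
    ultimately have "\<phi> (u \<otimes> s) \<otimes>\<^bsub>Q\<^esub> (p \<oplus>\<^bsub>Q\<^esub> q) = \<phi> (u \<otimes> a \<oplus> x \<otimes> b)"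
      using p q ux(1,2) by (simp add: Q.r_distr)
    then show "p \<oplus>\<^bsub>Q\<^esub> q \<in> ext I"
      using p q ux(1,2) I unfolding mem
      by (intro conjI bexI[of _ "u \<otimes> s"] bexI[of _ "u \<otimes> a \<oplus> x \<otimes> b"]) auto
  next
    fix p q assume "p \<in> carrier Q" "q \<in> ext I"
    then obtain t b where q: "q \<in> carrier Q" "t \<in> S" "b \<in> I" "\<phi> t \<otimes>\<^bsub>Q\<^esub> q = \<phi> b"
      unfolding mem by blast
    obtain s r where p: "s \<in> S" "r \<in> carrier R" "\<phi> s \<otimes>\<^bsub>Q\<^esub> p = \<phi> r"
      using left_fraction[OF \<open>p \<in> carrier Q\<close>] .
    \<comment> \<open>With \<open>p = s^{-1} r\<close> and \<open>q = t^{-1} b\<close>, the relation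
      \<open>u r = x t\<close> rewrites \<open>r t^{-1}\<close> as \<open>u^{-1} x\<close>, so
      \<open>p q = (u s)^{-1} x b\<close>.\<close>
    obtain u x where ux: "u \<in> S" "x \<in> carrier R" "u \<otimes> r = x \<otimes> t"
      using left_Ore p q by metis
    have "\<phi> (u \<otimes> s) \<otimes>\<^bsub>Q\<^esub> (p \<otimes>\<^bsub>Q\<^esub> q) = \<phi> u \<otimes>\<^bsub>Q\<^esub> (\<phi> s \<otimes>\<^bsub>Q\<^esub> p) \<otimes>\<^bsub>Q\<^esub> q"
      using p(1) ux(1) q(1) \<open>p \<in> carrier Q\<close> by (simp add: Q.m_assoc)
    also have "\<dots> = \<phi> (u \<otimes> r) \<otimes>\<^bsub>Q\<^esub> q"
      using p ux(1) by simp
    also have "\<dots> = \<phi> (x \<otimes> b)"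
      unfolding ux(3) using q ux(2) by (simp add: Q.m_assoc)
    finally show "p \<otimes>\<^bsub>Q\<^esub> q \<in> ext I"
      using p(1) q ux(1,2) I \<open>p \<in> carrier Q\<close> unfolding mem
      by (intro conjI bexI[of _ "u \<otimes> s"] bexI[of _ "x \<otimes> b"]) auto
  qed
qed

text \<open>Only closure under right multiplication is at stake. By \<open>right_fraction\<close> it
  splits into multiplication by images of elements of \<open>R\<close>, settled by \<open>I\<close>
  being a right ideal, and by inverses of images of \<open>S\<close>, where the Noetherian condition
  enters.\<close>

lemma ideal_ext:
  assumes noeth: "left_noetherian Q" and I: "ideal I R"
  shows "ideal (ext I) Q"
proof -
  interpret I: ideal I R by (rule I)
  have L: "left_ideal (ext I) Q"
    using left_ideal_ext I R.ideal_iff by blast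
  note LD = left_idealD[OF L]
  note mem = mem_ext_iff[OF I.a_subset]
  have hom_closed: "q \<otimes>\<^bsub>Q\<^esub> \<phi> r \<in> ext I" if q: "q \<in> ext I" and r: "r \<in> carrier R" for q r
  proof -
    obtain s a where a: "q \<in> carrier Q" "s \<in> S" "a \<in> I" "\<phi> s \<otimes>\<^bsub>Q\<^esub> q = \<phi> a"
      using q unfolding mem by blast
    then have "\<phi> s \<otimes>\<^bsub>Q\<^esub> (q \<otimes>\<^bsub>Q\<^esub> \<phi> r) = \<phi> (a \<otimes> r)"
      using r by (simp add: I.Icarr flip: Q.m_assoc)
    then show ?thesis
      unfolding mem using a r I.I_r_closed[OF a(3) r]
      by (intro conjI bexI[of _ s] bexI[of _ "a \<otimes> r"]) auto
  qed
  have inv_closed: "q \<otimes>\<^bsub>Q\<^esub> inv\<^bsub>Q\<^esub> (\<phi> s) \<in> ext I" if q: "q \<in> ext I" and s: "s \<in> S" for q s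
  proof -
    have qc: "q \<in> carrier Q"
      using q LD(1) by blast
    \<comment> \<open>\<open>K n\<close> is the left ideal \<open>(S^{-1}I) s^{-n}\<close>,
      described without inverses; the chain ascends by \<open>hom_closed\<close>.\<close>
    define K where "K n = {p \<in> carrier Q. p \<otimes>\<^bsub>Q\<^esub> (\<phi> s [^]\<^bsub>Q\<^esub> n) \<in> ext I}" for n :: nat
    have "left_ideal (K n) Q" for n
      using LD(2-4) s by (intro Q.left_idealI) (auto simp: K_def Q.l_distr Q.m_assoc)
    moreover have "K n \<subseteq> K (Suc n)" for n
      using hom_closed[OF _ S_carrier[OF s]] s by (auto simp: K_def simp flip: Q.m_assoc)
    ultimately obtain n where "\<forall>m\<ge>n. K m = K n"
      using noeth unfolding left_noetherian_def by blast
    then have n: "K (Suc n) = K n"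
      using le_SucI[OF order_refl] by blast
    let ?i = "inv\<^bsub>Q\<^esub> (\<phi> s)"
    have cancel: "(p \<otimes>\<^bsub>Q\<^esub> (?i [^]\<^bsub>Q\<^esub> m)) \<otimes>\<^bsub>Q\<^esub> (\<phi> s [^]\<^bsub>Q\<^esub> m) = p" if "p \<in> carrier Q" for p and m :: nat
    proof -
      have "?i [^]\<^bsub>Q\<^esub> m \<otimes>\<^bsub>Q\<^esub> \<phi> s [^]\<^bsub>Q\<^esub> m = (?i \<otimes>\<^bsub>Q\<^esub> \<phi> s) [^]\<^bsub>Q\<^esub> m"
        using s by (intro Q.pow_mult_distrib[symmetric]) auto
      then show ?thesis
        using s that by (simp add: Q.m_assoc)
    qed
    \<comment> \<open>The element \<open>q s^{-(n+1)}\<close> lies in \<open>K (Suc n)\<close>,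
      hence in \<open>K n\<close>; multiplying it by \<open>s^n\<close> leaves exactly one inverse,
      \<open>q s^{-1}\<close>, in \<open>ext I\<close>.\<close>
    have "q \<otimes>\<^bsub>Q\<^esub> ?i [^]\<^bsub>Q\<^esub> Suc n \<in> K (Suc n)"
      using qc q s cancel[OF qc, of "Suc n"] unfolding K_def by (simp del: Q.nat_pow_Suc)
    then have "q \<otimes>\<^bsub>Q\<^esub> ?i [^]\<^bsub>Q\<^esub> Suc n \<otimes>\<^bsub>Q\<^esub> \<phi> s [^]\<^bsub>Q\<^esub> n \<in> ext I"
      unfolding n by (simp add: K_def)
    moreover have "q \<otimes>\<^bsub>Q\<^esub> ?i [^]\<^bsub>Q\<^esub> Suc n = (q \<otimes>\<^bsub>Q\<^esub> ?i) \<otimes>\<^bsub>Q\<^esub> ?i [^]\<^bsub>Q\<^esub> n"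
      using qc s by (metis Q.nat_pow_Suc2 Q.m_assoc Q.nat_pow_closed inv_simps(1))
    ultimately show ?thesis
      using cancel[of "q \<otimes>\<^bsub>Q\<^esub> ?i" n] qc s by simp
  qed
  have "right_ideal (ext I) Q"
  proof (rule Q.right_idealI)
    fix q p assume p: "p \<in> carrier Q" and q: "q \<in> ext I"
    obtain s r where "s \<in> S" "r \<in> carrier R" "p = \<phi> r \<otimes>\<^bsub>Q\<^esub> inv\<^bsub>Q\<^esub> (\<phi> s)"
      using right_fraction[OF p] .
    moreover have "q \<in> carrier Q"
      using q LD(1) by blast
    ultimately show "q \<otimes>\<^bsub>Q\<^esub> p \<in> ext I"
      using inv_closed[OF hom_closed[OF q]] by (simp add: Q.m_assoc)
  qed (use LD in auto)
  with L show ?thesis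
    by (simp add: Q.ideal_iff)
qed

section \<open>Contraction of ideals and its interplay with extension\<close>

lemma left_ideal_contr:
  assumes "left_ideal J Q"
  shows "left_ideal (contr J) R"
  by (rule R.left_idealI) (use left_idealD[OF assms] in \<open>auto simp: contr_def\<close>)

lemma ideal_contr:
  assumes "ideal J Q"
  shows "ideal (contr J) R"
proof -
  have J: "left_ideal J Q" "right_ideal J Q"
    using assms by (simp_all add: Q.ideal_iff)
  have "right_ideal (contr J) R"
    by (rule R.right_idealI) (use right_idealD[OF J(2)] in \<open>auto simp: contr_def\<close>)
  then show ?thesis
    using left_ideal_contr[OF J(1)] by (simp add: R.ideal_iff)
qed

text \<open>For \<open>q\<close> in \<open>J\<close>, the numerator \<open>s q\<close> of a left
  fraction is again in \<open>J\<close>, so \<open>q\<close> is a fraction with numerator in the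
  contraction.\<close>

lemma ext_contr:
  assumes J: "left_ideal J Q"
  shows "ext (contr J) = J"
proof
  note J = left_idealD[OF J]
  show "ext (contr J) \<subseteq> J"
    using J by (auto simp: fractions_def contr_def)
  show "J \<subseteq> ext (contr J)"
  proof
    fix q assume q: "q \<in> J"
    then have qc: "q \<in> carrier Q"
      using J(1) by blast
    obtain s r where sr: "s \<in> S" "r \<in> carrier R" "\<phi> s \<otimes>\<^bsub>Q\<^esub> q = \<phi> r"
      using left_fraction[OF qc] .
    then have "r \<in> contr J"
      using J(4)[OF _ q, of "\<phi> s"] by (simp add: contr_def)
    then show "q \<in> ext (contr J)"
      using qc sr by (subst mem_ext_iff) (auto simp: contr_def)
  qed
qed

text \<open>By \<open>ext_contr\<close>, a left ideal is recovered from its contraction, so a chain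
  in \<open>Q\<close> stops where the contracted chain in \<open>R\<close> stops.\<close>

lemma left_noetherian_localization:
  assumes "left_noetherian R"
  shows "left_noetherian Q"
  unfolding left_noetherian_def
proof (intro allI impI, elim conjE)
  fix J :: "nat \<Rightarrow> 'b set"
  assume J: "\<forall>n. left_ideal (J n) Q" and inc: "\<forall>n. J n \<subseteq> J (Suc n)"
  have "\<forall>n. contr (J n) \<subseteq> contr (J (Suc n))"
    using inc by (auto simp: contr_def)
  then obtain n where "\<forall>m\<ge>n. contr (J m) = contr (J n)"
    using assms[unfolded left_noetherian_def, rule_format, of "\<lambda>n. contr (J n)"]
      J left_ideal_contr by blast
  then show "\<exists>n. \<forall>m\<ge>n. J m = J n"
    using J ext_contr by metis
qed

text \<open>Injectivity of \<open>\<phi>\<close> pulls the equation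
  \<open>\<phi> (s \<otimes> r) = \<phi> a\<close> back to \<open>R\<close>.\<close>

lemma mem_contr_ext_iff:
  assumes "I \<subseteq> carrier R"
  shows "r \<in> contr (ext I) \<longleftrightarrow> r \<in> carrier R \<and> (\<exists>s\<in>S. s \<otimes> r \<in> I)"
proof -
  have "(\<exists>a\<in>I. \<phi> s \<otimes>\<^bsub>Q\<^esub> \<phi> r = \<phi> a) \<longleftrightarrow> s \<otimes> r \<in> I" if "r \<in> carrier R" "s \<in> S" for s
  proof
    assume "\<exists>a\<in>I. \<phi> s \<otimes>\<^bsub>Q\<^esub> \<phi> r = \<phi> a"
    then obtain a where a: "a \<in> I" "\<phi> s \<otimes>\<^bsub>Q\<^esub> \<phi> r = \<phi> a"
      by blast
    then have "\<phi> (s \<otimes> r) = \<phi> a"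
      using that by simp
    then have "s \<otimes> r = a"
      using that a(1) assms by (intro inj_onD[OF inj]) auto
    then show "s \<otimes> r \<in> I"
      using a(1) by simp
  next
    assume "s \<otimes> r \<in> I"
    then show "\<exists>a\<in>I. \<phi> s \<otimes>\<^bsub>Q\<^esub> \<phi> r = \<phi> a"
      using that by (intro bexI[of _ "s \<otimes> r"]) auto
  qed
  then show ?thesis
    unfolding contr_def mem_Collect_eq mem_ext_iff[OF assms] by auto
qed

section \<open>The correspondence of primes\<close>

lemma prime_contr:
  assumes noeth: "left_noetherian Q" and P: "prime_ideal P Q"
  shows "prime_ideal (contr P) R"
proof (rule R.prime_idealI)
  note PD = prime_idealD[OF P]
  have PL: "left_ideal P Q"
    using PD(1) by (simp add: Q.ideal_iff)
  show "ideal (contr P) R"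
    using ideal_contr PD(1) .
  show "\<one> \<notin> contr P"
    using PD(2) by (simp add: contr_def)
  fix I J assume I: "ideal I R" and J: "ideal J R"
    and prod: "\<And>a b. a \<in> I \<Longrightarrow> b \<in> J \<Longrightarrow> a \<otimes> b \<in> contr P"
  have sub: "I \<subseteq> carrier R" "J \<subseteq> carrier R"
    using I J by (auto intro: ideal.Icarr)
  have "p \<otimes>\<^bsub>Q\<^esub> q \<in> P" if p: "p \<in> ext I" and q: "q \<in> ext J" for p q
  proof -
    obtain t b where b: "t \<in> S" "b \<in> J" "q = inv\<^bsub>Q\<^esub> (\<phi> t) \<otimes>\<^bsub>Q\<^esub> \<phi> b"
      using q by (auto simp: fractions_def)
    have pc: "p \<in> carrier Q"
      using p sub(1) by (simp add: mem_ext_iff)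
    \<comment> \<open>\<open>ext I\<close> is two-sided, so it absorbs the denominator
      \<open>t\<close> of \<open>q\<close>; then \<open>p q = s^{-1} (a b)\<close> with
      \<open>a\<close> in \<open>I\<close> and \<open>b\<close> in \<open>J\<close>.\<close>
    have "p \<otimes>\<^bsub>Q\<^esub> inv\<^bsub>Q\<^esub> (\<phi> t) \<in> ext I"
      using ideal.I_r_closed[OF ideal_ext[OF noeth I] p] b(1) by simp
    then obtain s a where a: "s \<in> S" "a \<in> I" "p \<otimes>\<^bsub>Q\<^esub> inv\<^bsub>Q\<^esub> (\<phi> t) = inv\<^bsub>Q\<^esub> (\<phi> s) \<otimes>\<^bsub>Q\<^esub> \<phi> a"
      by (auto simp: fractions_def)
    have carr: "a \<in> carrier R" "b \<in> carrier R"
      using a b sub by auto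
    have "p \<otimes>\<^bsub>Q\<^esub> q = p \<otimes>\<^bsub>Q\<^esub> inv\<^bsub>Q\<^esub> (\<phi> t) \<otimes>\<^bsub>Q\<^esub> \<phi> b"
      using b pc carr by (simp add: Q.m_assoc)
    also have "\<dots> = inv\<^bsub>Q\<^esub> (\<phi> s) \<otimes>\<^bsub>Q\<^esub> \<phi> (a \<otimes> b)"
      unfolding a(3) using a(1) carr by (simp add: Q.m_assoc)
    also have "\<dots> \<in> P"
      using left_idealD(4)[OF PL] prod[OF a(2) b(2)] a(1) by (simp add: contr_def)
    finally show ?thesis .
  qed
  then have "ext I \<subseteq> P \<or> ext J \<subseteq> P"
    using PD(3) ideal_ext[OF noeth] I J by blast
  moreover have "K \<subseteq> contr P" if K: "K \<subseteq> carrier R" "ext K \<subseteq> P" for K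
  proof
    fix a assume a: "a \<in> K"
    then have "\<phi> a \<in> ext K"
      unfolding mem_ext_iff[OF K(1)] using K(1) by (intro conjI bexI[of _ \<one>] bexI[of _ a]) auto
    then show "a \<in> contr P"
      using K a by (auto simp: contr_def)
  qed
  ultimately show "I \<subseteq> contr P \<or> J \<subseteq> contr P"
    using sub by blast
qed

lemma prime_contr_disjoint:
  assumes P: "prime_ideal P Q"
  shows "contr P \<inter> S = {}"
proof (rule ccontr)
  assume "contr P \<inter> S \<noteq> {}"
  then obtain s where s: "s \<in> S" "\<phi> s \<in> P"
    by (auto simp: contr_def)
  then have "inv\<^bsub>Q\<^esub> (\<phi> s) \<otimes>\<^bsub>Q\<^esub> \<phi> s \<in> P"
    using ideal.I_l_closed[OF prime_idealD(1)[OF P]] inv_simps(1) by blast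
  then show False
    using s prime_idealD(2)[OF P] by simp
qed

lemma contr_ext_prime:
  assumes rnoeth: "right_noetherian R" and noeth: "left_noetherian Q"
    and P: "prime_ideal P R" and disj: "P \<inter> S = {}"
  shows "contr (ext P) = P"
proof
  interpret P: ideal P R by (rule prime_idealD(1)[OF P])
  note mem = mem_contr_ext_iff[OF P.a_subset]
  show "P \<subseteq> contr (ext P)"
    using P.a_subset by (auto simp: mem intro!: bexI[of _ \<one>])
  define T where "T s = {r \<in> carrier R. s \<otimes> r \<in> P}" for s
  have "right_ideal (T s) R" if "s \<in> S" for s
    using that by (intro R.right_idealI) (auto simp: T_def R.r_distr P.I_r_closed simp flip: R.m_assoc)
  \<comment> \<open>The left Ore condition supplies \<open>w\<close> as a common left multiple of
    \<open>s\<close> and \<open>t\<close>; left multiples of elements of \<open>P\<close> stay in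
    \<open>P\<close>, so \<open>T w\<close> contains both sets.\<close>
  moreover have "\<exists>w\<in>S. T s \<subseteq> T w \<and> T t \<subseteq> T w" if st: "s \<in> S" "t \<in> S" for s t
  proof -
    obtain u x where ux: "u \<in> S" "x \<in> carrier R" "u \<otimes> s = x \<otimes> t"
      using left_Ore st by (metis S_carrier)
    have "T s \<subseteq> T (u \<otimes> s)"
      using st ux(1) by (auto simp: T_def R.m_assoc P.I_l_closed)
    moreover have "T t \<subseteq> T (u \<otimes> s)"
      unfolding ux(3) using st ux(2) by (auto simp: T_def R.m_assoc P.I_l_closed)
    ultimately show ?thesis
      using st ux(1) by (metis S_mult)
  qed
  ultimately obtain s where s: "s \<in> S" and max: "\<And>t. t \<in> S \<Longrightarrow> T t \<subseteq> T s"
    using right_noetherian_directed_max[OF rnoeth, of S T] S_one by (metis empty_iff)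
  \<comment> \<open>Each \<open>r\<close> of the contraction lies in some \<open>T t\<close>, hence
    in the largest member \<open>T s\<close>: one \<open>s\<close> works for all
    \<open>r\<close>.\<close>
  have "s \<otimes> r \<in> P" if "r \<in> contr (ext P)" for r
    using that max unfolding mem T_def by blast
  moreover have "s \<notin> P"
    using disj s by blast
  ultimately show "contr (ext P) \<subseteq> P"
    using s by (intro R.prime_ideal_elementwise[OF P _ ideal_contr[OF ideal_ext[OF noeth]]])
      (auto simp: P.ideal_axioms)
qed

text \<open>Ideals of \<open>Q\<close> with product inside \<open>ext P\<close> are contracted to
  \<open>R\<close>, where \<open>contr_ext_prime\<close> puts the product of the contractions in
  \<open>P\<close>; extending again recovers them by \<open>ext_contr\<close>.\<close>

lemma prime_ext:
  assumes rnoeth: "right_noetherian R" and noeth: "left_noetherian Q"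
    and P: "prime_ideal P R" and disj: "P \<inter> S = {}"
  shows "prime_ideal (ext P) Q"
proof (rule Q.prime_idealI)
  note PD = prime_idealD[OF P]
  note ce = contr_ext_prime[OF assms]
  show "ideal (ext P) Q"
    using ideal_ext[OF noeth PD(1)] .
  show "\<one>\<^bsub>Q\<^esub> \<notin> ext P"
  proof
    assume "\<one>\<^bsub>Q\<^esub> \<in> ext P"
    then have "\<one> \<in> contr (ext P)"
      by (simp add: contr_def)
    then show False
      using PD(2) by (simp add: ce)
  qed
  fix I J assume I: "ideal I Q" and J: "ideal J Q"
    and prod: "\<And>a b. a \<in> I \<Longrightarrow> b \<in> J \<Longrightarrow> a \<otimes>\<^bsub>Q\<^esub> b \<in> ext P"
  have "a \<otimes> b \<in> P" if "a \<in> contr I" "b \<in> contr J" for a b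
  proof -
    have "a \<otimes> b \<in> contr (ext P)"
      using that prod by (simp add: contr_def)
    then show ?thesis
      by (simp add: ce)
  qed
  then have "contr I \<subseteq> P \<or> contr J \<subseteq> P"
    using PD(3) ideal_contr I J by blast
  then have "ext (contr I) \<subseteq> ext P \<or> ext (contr J) \<subseteq> ext P"
    by (auto simp: fractions_def)
  then show "I \<subseteq> ext P \<or> J \<subseteq> ext P"
    using I J by (simp add: ext_contr Q.ideal_iff)
qed

lemma contr_mono: "I \<subseteq> J \<Longrightarrow> contr I \<subseteq> contr J"
  by (auto simp: contr_def)

lemma ext_mono: "I \<subseteq> J \<Longrightarrow> ext I \<subseteq> ext J"
  by (auto simp: fractions_def)

lemma ext_contr_prime: "prime_ideal P Q \<Longrightarrow> ext (contr P) = P"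
  using ext_contr prime_idealD(1) Q.ideal_iff by metis

lemma min_primes_localization:
  assumes rnoeth: "right_noetherian R" and noeth: "left_noetherian Q"
  shows "min_primes Q = {ext P | P. P \<in> min_primes_avoiding R S}"
proof (intro subset_antisym subsetI)
  fix P assume "P \<in> min_primes Q"
  then have P: "prime_ideal P Q" and min: "\<And>P'. prime_ideal P' Q \<Longrightarrow> P' \<subseteq> P \<Longrightarrow> P' = P"
    by (auto simp: min_primes_def)
  have "P' = contr P" if P': "prime_ideal P' R" "P' \<subseteq> contr P" for P'
  proof -
    \<comment> \<open>Disjointness from \<open>S\<close> passes to smaller primes, so minimality of
      \<open>contr P\<close> holds among all primes of \<open>R\<close>, not just among those
      avoiding \<open>S\<close>.\<close>
    have disj: "P' \<inter> S = {}"
      using P' prime_contr_disjoint[OF P] by blast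
    have "ext P' \<subseteq> P"
      using ext_mono[OF P'(2)] ext_contr_prime[OF P] by simp
    then have "ext P' = P"
      using min prime_ext[OF rnoeth noeth P'(1) disj] by blast
    then show ?thesis
      using contr_ext_prime[OF rnoeth noeth P'(1) disj] by simp
  qed
  then have "contr P \<in> min_primes_avoiding R S"
    using prime_contr[OF noeth P] prime_contr_disjoint[OF P]
    by (auto simp: min_primes_avoiding_def min_primes_def)
  then show "P \<in> {ext P | P. P \<in> min_primes_avoiding R S}"
    using ext_contr_prime[OF P] by blast
next
  fix P' assume "P' \<in> {ext P | P. P \<in> min_primes_avoiding R S}"
  then obtain P where P: "prime_ideal P R" "P \<inter> S = {}" and P': "P' = ext P"
    and min: "\<And>P'. prime_ideal P' R \<Longrightarrow> P' \<subseteq> P \<Longrightarrow> P' = P"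
    by (auto simp: min_primes_def min_primes_avoiding_def)
  have "J = ext P" if J: "prime_ideal J Q" "J \<subseteq> ext P" for J
  proof -
    have "contr J \<subseteq> P"
      using contr_mono[OF J(2)] contr_ext_prime[OF rnoeth noeth P] by simp
    then have "contr J = P"
      using min prime_contr[OF noeth J(1)] by blast
    then show ?thesis
      using ext_contr_prime[OF J(1)] by simp
  qed
  then show "P' \<in> min_primes Q"
    using prime_ext[OF rnoeth noeth P] by (auto simp: min_primes_def P')
qed

lemma one_neq_zero: "\<one>\<^bsub>Q\<^esub> \<noteq> \<zero>\<^bsub>Q\<^esub>"
proof
  assume "\<one>\<^bsub>Q\<^esub> = \<zero>\<^bsub>Q\<^esub>"
  then have "\<phi> \<one> = \<phi> \<zero>"
    by simp
  then have "\<one> = \<zero>"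
    using inj_onD[OF inj] by blast
  then show False
    using S_one S(2) by simp
qed

end

section \<open>From denominator sets to the final statement\<close>

lemma regular_localizationI:
  assumes "ring R" "S \<in> Den R {\<zero>\<^bsub>R\<^esub>}" "is_localization R S Q \<phi>"
  shows "regular_localization R Q S \<phi>"
proof -
  have Q: "ring Q" and hom: "\<phi> \<in> ring_hom R Q" and unit: "\<phi> ` S \<subseteq> Units Q"
    and ker: "a_kernel R Q \<phi> = {\<zero>\<^bsub>R\<^esub>}" and fracs: "carrier Q = fractions Q \<phi> S (carrier R)"
    using assms(2,3) by (auto simp: is_localization_def Den_def)
  have lO: "left_Ore_set R S" and rO: "right_Ore_set R S"
    using assms(2) by (auto simp: Den_def left_denominator_set_def right_denominator_set_def)
  have S: "submonoid S R" "\<zero>\<^bsub>R\<^esub> \<notin> S"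
    using lO by (auto simp: left_Ore_set_def multiplicative_subset_def)
  interpret ring_hom_ring R Q \<phi>
    using assms(1) Q hom by (simp add: ring_hom_ringI2)
  show ?thesis
  proof (intro regular_localization.intro regular_localization_axioms.intro assms(1) Q hom S fracs)
    show "inj_on \<phi> (carrier R)"
      using trivial_ker_imp_inj[OF ker] .
    show "\<exists>u\<in>S. \<exists>x\<in>carrier R. u \<otimes>\<^bsub>R\<^esub> r = x \<otimes>\<^bsub>R\<^esub> s" if "r \<in> carrier R" "s \<in> S" for r s
      using lO that unfolding left_Ore_set_def r_coset_def by blast
    show "\<exists>u\<in>S. \<exists>x\<in>carrier R. r \<otimes>\<^bsub>R\<^esub> u = s \<otimes>\<^bsub>R\<^esub> x" if "r \<in> carrier R" "s \<in> S" for r s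
      using rO that unfolding right_Ore_set_def l_coset_def by blast
  qed (use unit in blast)
qed

text \<open>The last conjunct accounts for the example of a Noetherian \<open>R\<close>: left
  Noetherianity passes from \<open>R\<close> to the localization.\<close>

theorem corollary1p3:
  fixes R :: "('a, 'm) ring_scheme" and S :: "'a set"
    and Q :: "('b, 'n) ring_scheme" and \<phi> :: "'a \<Rightarrow> 'b"
  assumes "ring R"
    and "right_noetherian R"
    and "S \<in> Den R {\<zero>\<^bsub>R\<^esub>}"
    and "is_localization R S Q \<phi>"
  shows "(left_noetherian Q \<longrightarrow>
            min_primes Q = {fractions Q \<phi> S P | P. P \<in> min_primes_avoiding R S} \<and>
            min_primes_avoiding R S \<noteq> {}) \<and>
         (left_noetherian R \<longrightarrow> left_noetherian Q)"
proof -
  interpret regular_localization R Q S \<phi>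
    using assms by (intro regular_localizationI)
  show ?thesis
    \<comment> \<open>\<open>Q\<close> is nonzero and so has a minimal prime; by the equality it is
      extended from a member of \<open>min_primes_avoiding R S\<close>, which is therefore
      nonempty.\<close>
    using min_primes_localization[OF assms(2)] Q.exists_min_prime[OF one_neq_zero]
      left_noetherian_localization by blast
qed

end
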